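(* Let $P,Q\in\mathbb Z$ with $Q=\pm1$ and $\Delta=P^2+4Q>0$, and assume the Lucas sequence $U_n=U_n(P,Q)$ is nondegenerate. Let $k\ge2$, let $A\in\mathbb Z\setminus\{0\}$, and suppose that $n_1,\ldots,n_r$ are pairwise coprime positive integers. If $$A y^k=\prod_{i=1}^r U_{n_i}(P,Q)$$ for some $y\in\mathbb Z$, then for every $i$ there exist $s_i\in\mathbb Z_{\ge1}$ and a $k$-th-power-free integer $e_i$ such that $$U_{n_i}=e_i s_i^k,$$ and every prime divisor of $e_i$ divides $A$. Equivalently, for every rational prime $p\nmid A$, one has $v_p(U_{n_i})\equiv0\pmod k$ for all $1\le i\le r$.
   Context: The Lucas sequence $U_n=U_n(P,Q)$ is defined by $U_0=0$, $U_1=1$, $U_{n+2}=PU_{n+1}+QU_n$. Let $\alpha,\beta$ be the roots of $x^2-Px-Q$. The sequence is nondegenerate if $\alpha/\beta$ is not a root of unity (then $U_n\neq0$ for $n\ge1$). A nonzero integer $e$ (possibly negative) is $k$-th-power-free if $p^k\nmid e$ for every rational prime $p$. $v_p$ is the $p$-adic valuation. *)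

theory Defs
  imports Complex_Main "HOL-Computational_Algebra.Polynomial" "HOL-Number_Theory.Number_Theory"
begin

fun lucas_U :: "int \<Rightarrow> int \<Rightarrow> nat \<Rightarrow> int" where
  "lucas_U P Q 0 = 0"
| "lucas_U P Q (Suc 0) = 1"
| "lucas_U P Q (Suc (Suc n)) = P * lucas_U P Q (Suc n) + Q * lucas_U P Q n"

definition root_of_unity :: "complex \<Rightarrow> bool" where
  "root_of_unity z \<longleftrightarrow> (\<exists>m::nat. m > 0 \<and> z ^ m = 1)"

(* The factorisation X^2 - P X - Q = (X - \<alpha>) (X - \<beta>) makes \<alpha>, \<beta> the two roots
   with multiplicity. It always exists over the complex numbers and is unique up to swapping
   \<alpha> and \<beta>, so quantifying universally over (\<alpha>, \<beta>) is the same as choosing a labelling.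
   Meant for Q \<noteq> 0: otherwise one of the roots is 0 and \<alpha> / \<beta> may be a division by zero. *)
definition lucas_nondegenerate :: "int \<Rightarrow> int \<Rightarrow> bool" where
  "lucas_nondegenerate P Q \<longleftrightarrow>
     (\<forall>\<alpha> \<beta> :: complex.
        [:- of_int Q, - of_int P, 1:] = [:- \<alpha>, 1:] * [:- \<beta>, 1:] \<longrightarrow> \<not> root_of_unity (\<alpha> / \<beta>))"

(* Primes of type int are positive, so p ranges over the rational primes. *)
definition kth_power_free :: "nat \<Rightarrow> int \<Rightarrow> bool" where
  "kth_power_free k e \<longleftrightarrow> e \<noteq> 0 \<and> (\<forall>p::int. prime p \<longrightarrow> \<not> p ^ k dvd e)"

end

theory Submission
  imports Defs
begin

text \<open>
  Because \<open>Q\<close> is a unit, it is coprime to \<open>P\<close>, and this makes the Lucas sequence a strong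
  divisibility sequence: \<open>gcd (U m) (U n)\<close> is \<open>U (gcd m n)\<close> up to sign (\<open>gcd_lucas_U\<close>).
  Pairwise coprime indices therefore give pairwise coprime terms, since \<open>U 1 = 1\<close>. Nondegeneracy makes every term of positive index nonzero
  (\<open>lucas_U_nonzero\<close>), by Binet's formula.

  Let \<open>p\<close> be a prime that does not divide \<open>A\<close>. At most one of the factors on the right of
  \<open>A * y ^ k = (\<Prod>i. U (n i))\<close> is divisible by \<open>p\<close>, so the valuation of that factor
  is the valuation of the left-hand side, which is \<open>k\<close> times that of \<open>y\<close>.
  Splitting off \<open>k\<close>-th powers of primes from \<open>U (n i)\<close> leaves a \<open>k\<close>-th-power-free cofactor
  (\<open>kth_power_free_decomposition\<close>) whose valuation at \<open>p\<close> is less than \<open>k\<close> and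
  divisible by \<open>k\<close>, hence zero.
\<close>

lemma lucas_U_add:
  "lucas_U P Q (Suc (m + n)) =
     lucas_U P Q (Suc m) * lucas_U P Q (Suc n) + Q * lucas_U P Q m * lucas_U P Q n"
proof (induction m arbitrary: n)
  case (Suc m)
  show ?case
    using Suc[of "Suc n"] by (simp add: algebra_simps)
qed simp

lemma coprime_lucas_U_Suc_param:
  assumes "coprime P Q"
  shows "coprime (lucas_U P Q (Suc n)) Q"
proof (induction n)
  case (Suc n)
  have "coprime (P * lucas_U P Q (Suc n)) Q"
    using Suc assms by simp
  then show ?case
    using gcd_add_mult[of Q "lucas_U P Q n" "P * lucas_U P Q (Suc n)"]
    by (simp add: coprime_iff_gcd_eq_1 gcd.commute add.commute mult.commute)
qed simp

lemma coprime_lucas_U_Suc: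
  assumes "coprime P Q"
  shows "coprime (lucas_U P Q n) (lucas_U P Q (Suc n))"
proof (induction n)
  case (Suc n)
  have "coprime (lucas_U P Q (Suc n)) (Q * lucas_U P Q n)"
    using Suc coprime_lucas_U_Suc_param[OF assms, of n] by (simp add: coprime_commute)
  then show ?case
    using gcd_add_mult[of "lucas_U P Q (Suc n)" P "Q * lucas_U P Q n"]
    by (simp add: coprime_iff_gcd_eq_1)
qed simp

text \<open>
  A subtraction step of the Euclidean algorithm on the indices. For \<open>n > 0\<close> the addition formula,
  taken modulo \<open>U n\<close>, makes \<open>U (n + m)\<close> congruent to \<open>Q * U (n - 1) * U m\<close>, whose cofactor of \<open>U m\<close> is coprime to \<open>U n\<close>.
\<close>

lemma gcd_lucas_U_add:
  assumes "coprime P Q"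
  shows "gcd (lucas_U P Q n) (lucas_U P Q (n + m)) = gcd (lucas_U P Q n) (lucas_U P Q m)"
proof (cases n)
  case (Suc n')
  have "lucas_U P Q (n + m) =
      lucas_U P Q (Suc m) * lucas_U P Q n + (Q * lucas_U P Q n') * lucas_U P Q m"
    using lucas_U_add[of P Q n' m] Suc by (simp add: mult.commute)
  moreover have "coprime (lucas_U P Q n) (Q * lucas_U P Q n')"
    using coprime_lucas_U_Suc_param[OF assms, of n'] coprime_lucas_U_Suc[OF assms, of n'] Suc
    by (simp add: coprime_commute)
  ultimately show ?thesis
    by (metis gcd_add_mult gcd_mult_left_left_cancel gcd.commute)
qed simp

lemma gcd_lucas_U_mod:
  assumes "coprime P Q"
  shows "gcd (lucas_U P Q n) (lucas_U P Q (m mod n)) = gcd (lucas_U P Q n) (lucas_U P Q m)"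
proof -
  have "gcd (lucas_U P Q n) (lucas_U P Q (q * n + r)) = gcd (lucas_U P Q n) (lucas_U P Q r)" for q r
    by (induction q) (simp_all add: gcd_lucas_U_add[OF assms] add.assoc)
  from this[of "m div n" "m mod n"] show ?thesis by simp
qed

theorem gcd_lucas_U:
  assumes "coprime P Q"
  shows "gcd (lucas_U P Q m) (lucas_U P Q n) = \<bar>lucas_U P Q (gcd m n)\<bar>"
proof (induction m n rule: gcd_nat_induct)
  case (step m n)
  then show ?case
    by (metis gcd.commute gcd_lucas_U_mod[OF assms] gcd_red_nat)
qed simp

text \<open>Binet's formula, multiplied out so that it also holds for a double root.\<close>

lemma lucas_U_Binet:
  fixes \<alpha> \<beta> :: "'a::comm_ring_1"
  assumes "\<alpha> + \<beta> = of_int P" and "\<alpha> * \<beta> = - of_int Q"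
  shows "of_int (lucas_U P Q n) * (\<alpha> - \<beta>) = \<alpha> ^ n - \<beta> ^ n"
  using assms
proof (induction P Q n rule: lucas_U.induct)
  case (3 P Q n)
  have P: "of_int P = \<alpha> + \<beta>" and Q: "of_int Q = - (\<alpha> * \<beta>)"
    using 3(3,4) by simp_all
  have "of_int (lucas_U P Q (Suc (Suc n))) * (\<alpha> - \<beta>) =
      of_int P * (of_int (lucas_U P Q (Suc n)) * (\<alpha> - \<beta>)) +
      of_int Q * (of_int (lucas_U P Q n) * (\<alpha> - \<beta>))"
    by (simp add: ring_distribs mult.assoc)
  also have "\<dots> = (\<alpha> + \<beta>) * (\<alpha> ^ Suc n - \<beta> ^ Suc n) + - (\<alpha> * \<beta>) * (\<alpha> ^ n - \<beta> ^ n)"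
    unfolding 3(1)[OF 3(3,4)] 3(2)[OF 3(3,4)] unfolding P Q ..
  also have "\<dots> = \<alpha> ^ Suc (Suc n) - \<beta> ^ Suc (Suc n)"
    by (simp add: algebra_simps)
  finally show ?case .
qed simp_all

lemma lucas_U_nonzero:
  assumes "lucas_nondegenerate P Q" and "Q \<noteq> 0" and "n > 0"
  shows "lucas_U P Q n \<noteq> 0"
proof
  assume zero: "lucas_U P Q n = 0"
  define d where "d = csqrt (of_int (P\<^sup>2 + 4 * Q))"
  define \<alpha> \<beta> where "\<alpha> = (of_int P + d) / 2" and "\<beta> = (of_int P - d) / 2"
  have d: "d\<^sup>2 = (of_int P)\<^sup>2 + 4 * of_int Q"
    by (simp add: d_def)
  have sum: "\<alpha> + \<beta> = of_int P"
    by (simp add: \<alpha>_def \<beta>_def field_simps)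
  have prod: "\<alpha> * \<beta> = - of_int Q"
  proof -
    have "\<alpha> * \<beta> = ((of_int P)\<^sup>2 - d\<^sup>2) / 4"
      by (simp add: \<alpha>_def \<beta>_def power2_eq_square field_simps)
    then show ?thesis using d by simp
  qed
  have "\<alpha> ^ n = \<beta> ^ n"
    using lucas_U_Binet[OF sum prod, of n] zero by simp
  moreover have "\<beta> \<noteq> 0"
    using prod \<open>Q \<noteq> 0\<close> by auto
  ultimately have "(\<alpha> / \<beta>) ^ n = 1"
    by (simp add: power_divide)
  then have "root_of_unity (\<alpha> / \<beta>)"
    using \<open>n > 0\<close> by (auto simp: root_of_unity_def)
  moreover have "[:- of_int Q, - of_int P, 1:] = [:- \<alpha>, 1:] * [:- \<beta>, 1:]"
    using sum prod by (simp add: algebra_simps flip: sum)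
  ultimately show False
    using assms(1) unfolding lucas_nondegenerate_def by blast
qed

lemma kth_power_free_decomposition:
  fixes x :: int
  assumes "x \<noteq> 0" and "k > 0"
  obtains s e where "s \<ge> 1" and "kth_power_free k e" and "x = e * s ^ k"
proof -
  have "\<exists>s e. s \<ge> 1 \<and> kth_power_free k e \<and> x = e * s ^ k"
    using assms(1)
  proof (induction "nat \<bar>x\<bar>" arbitrary: x rule: less_induct)
    case less
    show ?case
    proof (cases "kth_power_free k x")
      case True
      then show ?thesis by (intro exI[of _ 1] exI[of _ x]) simp
    next
      case False
      then obtain p z where p: "prime p" and x: "x = p ^ k * z"
        using less.prems unfolding kth_power_free_def by (auto elim: dvdE)
      have "p ^ k > 1"
        using prime_gt_1_int[OF p] \<open>k > 0\<close> by simp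
      moreover have "z \<noteq> 0" using x less.prems by auto
      ultimately have "\<bar>z\<bar> < \<bar>x\<bar>"
        unfolding x abs_mult by simp
      then have "nat \<bar>z\<bar> < nat \<bar>x\<bar>" by simp
      then obtain s e where "s \<ge> 1" "kth_power_free k e" "z = e * s ^ k"
        using less.hyps \<open>z \<noteq> 0\<close> by blast
      moreover have "p * s \<ge> 1"
        using \<open>s \<ge> 1\<close> prime_gt_0_int[OF p] by (simp add: int_one_le_iff_zero_less)
      ultimately show ?thesis
        using x by (intro exI[of _ "p * s"] exI[of _ e]) (simp add: power_mult_distrib)
    qed
  qed
  then show thesis using that by blast
qed

lemma multiplicity_mult_power:
  fixes p a s :: int
  assumes "prime p" and "a \<noteq> 0" and "s \<noteq> 0"
  shows "multiplicity p (a * s ^ k) = multiplicity p a + k * multiplicity p s"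
proof -
  have "prime_elem p" using assms(1) by (rule prime_imp_prime_elem)
  then show ?thesis
    using assms(2,3)
    by (simp add: prime_elem_multiplicity_mult_distrib prime_elem_multiplicity_power_distrib)
qed

lemma kth_power_free_prime_not_dvd:
  fixes p e s :: int
  assumes "kth_power_free k e" and "s \<noteq> 0" and "prime p"
    and "k dvd multiplicity p (e * s ^ k)"
  shows "\<not> p dvd e"
proof -
  have "e \<noteq> 0" and "\<not> p ^ k dvd e"
    using assms(1,3) by (auto simp: kth_power_free_def)
  have "multiplicity p (e * s ^ k) = multiplicity p e + k * multiplicity p s"
    using multiplicity_mult_power[OF assms(3) \<open>e \<noteq> 0\<close> assms(2)] .
  then have "k dvd multiplicity p e"
    using assms(4) by (simp add: dvd_add_left_iff)
  moreover have "multiplicity p e < k"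
    using \<open>\<not> p ^ k dvd e\<close> multiplicity_dvd' not_less by blast
  ultimately have "multiplicity p e = 0"
    using nat_dvd_not_less by blast
  then show ?thesis
    using \<open>e \<noteq> 0\<close> \<open>prime p\<close> prime_elem_multiplicity_eq_zero_iff by blast
qed

lemma multiplicity_pairwise_coprime_prod:
  fixes p :: int and f :: "'a \<Rightarrow> int"
  assumes "finite I" and "pairwise (\<lambda>i j. coprime (f i) (f j)) I" and "prime p"
    and "i \<in> I" and "p dvd f i" and "\<And>j. j \<in> I \<Longrightarrow> f j \<noteq> 0"
  shows "multiplicity p (\<Prod>j\<in>I. f j) = multiplicity p (f i)"
proof -
  have "multiplicity p (f j) = 0" if "j \<in> I - {i}" for j
  proof -
    have "coprime (f i) (f j)"
      using assms(2,4) that by (auto simp: pairwise_def)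
    then have "\<not> p dvd f j"
      using assms(3,5) by (meson coprime_common_divisor not_prime_unit)
    then show ?thesis by (rule not_dvd_imp_multiplicity_0)
  qed
  then have "(\<Sum>j\<in>I. multiplicity p (f j)) = multiplicity p (f i)"
    using assms(1,4) by (simp add: sum.remove)
  moreover have "multiplicity p (\<Prod>j\<in>I. f j) = (\<Sum>j\<in>I. multiplicity p (f j))"
    using assms(1,3,6) by (intro prime_elem_multiplicity_prod_distrib) auto
  ultimately show ?thesis by simp
qed

theorem theorem7p1:
  fixes P Q A y :: int and k r :: nat and n :: "nat \<Rightarrow> nat"
  assumes "Q = 1 \<or> Q = -1"
    and "P ^ 2 + 4 * Q > 0"
    and "lucas_nondegenerate P Q"
    and "k \<ge> 2"
    and "A \<noteq> 0"
    and "\<forall>i\<in>{1..r}. n i > 0"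
    and "pairwise (\<lambda>i j. coprime (n i) (n j)) {1..r}"
    and "A * y ^ k = (\<Prod>i=1..r. lucas_U P Q (n i))"
  shows "(\<forall>i\<in>{1..r}. \<exists>s e :: int. s \<ge> 1 \<and> kth_power_free k e \<and>
            lucas_U P Q (n i) = e * s ^ k \<and>
            (\<forall>p::int. prime p \<and> p dvd e \<longrightarrow> p dvd A))
       \<and> (\<forall>p::int. prime p \<and> \<not> p dvd A \<longrightarrow>
            (\<forall>i\<in>{1..r}. [multiplicity p (lucas_U P Q (n i)) = 0] (mod k)))"
proof -
  let ?U = "\<lambda>i. lucas_U P Q (n i)"
  have "coprime P Q" and "Q \<noteq> 0"
    using assms(1) by auto
  have nonzero: "?U i \<noteq> 0" if "i \<in> {1..r}" for i
    using lucas_U_nonzero[OF assms(3) \<open>Q \<noteq> 0\<close>] assms(6) that by blast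
  have coprime: "pairwise (\<lambda>i j. coprime (?U i) (?U j)) {1..r}"
    using assms(7)
  proof (rule pairwise_mono)
    fix i j
    assume "coprime (n i) (n j)"
    then show "coprime (?U i) (?U j)"
      using gcd_lucas_U[OF \<open>coprime P Q\<close>, of "n i" "n j"] by (intro gcd_eq_1_imp_coprime) simp
  qed simp
  have "A * y ^ k \<noteq> 0"
    using assms(8) nonzero by simp
  then have "y \<noteq> 0"
    using assms(4) by auto
  have valuation: "k dvd multiplicity p (?U i)"
    if p: "prime p" "\<not> p dvd A" and i: "i \<in> {1..r}" for p i
  proof (cases "p dvd ?U i")
    case True
    have "multiplicity p (?U i) = multiplicity p (\<Prod>i=1..r. ?U i)"
      using multiplicity_pairwise_coprime_prod[OF _ coprime p(1) i True] nonzero by simp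
    also have "\<dots> = multiplicity p (A * y ^ k)"
      using assms(8) by simp
    also have "\<dots> = k * multiplicity p y"
      using multiplicity_mult_power[OF p(1) \<open>A \<noteq> 0\<close> \<open>y \<noteq> 0\<close>] p(2)
      by (simp add: not_dvd_imp_multiplicity_0)
    finally show ?thesis by simp
  next
    case False
    then show ?thesis by (simp add: not_dvd_imp_multiplicity_0)
  qed
  have "\<exists>s e :: int. s \<ge> 1 \<and> kth_power_free k e \<and> ?U i = e * s ^ k \<and>
      (\<forall>p::int. prime p \<and> p dvd e \<longrightarrow> p dvd A)" if i: "i \<in> {1..r}" for i
  proof -
    obtain s e where se: "s \<ge> 1" "kth_power_free k e" "?U i = e * s ^ k"
      using kth_power_free_decomposition[OF nonzero[OF i], of k] assms(4) by auto
    have "p dvd A" if "prime p" "p dvd e" for p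
      using kth_power_free_prime_not_dvd[OF se(2), of s p] valuation[of p i] se(1,3) that i by auto
    then show ?thesis using se by blast
  qed
  then show ?thesis
    using valuation by (simp add: cong_0_iff)
qed

end
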